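(* Let $X$ be a finite alphabet and let $S$ denote one of the semigroups $Fin\mathcal{A}(X)$ or $Fin\mathcal{PA}(X)$. Two elements $f,g\in S$ are $S$-conjugate if and only if $\overline{fe_f}$ and $\overline{ge_g}$ are $Fin\mathcal{SA}(X)$-conjugate.
   Context: An initial (partial Mealy) automaton over a finite alphabet $X$ consists of a set $Q$ of internal states, a partial transition function $\varphi:Q\times X\to Q$, a partial output function $\psi:Q\times X\to X$ and an initial state $q_0\in Q$. Extend $\varphi$ to words by $\varphi(q,e)=q$ ($e$ the empty word), $\varphi(q,wx)=\varphi(\varphi(q,w),x)$. The automaton defines the partial transformation of the set $X^*$ of all words over $X$ sending $u=x_1x_2x_3\dots$ to $\psi(q_0,x_1)\psi(\varphi(q_0,x_1),x_2)\psi(\varphi(q_0,x_1x_2),x_3)\dots$, undefined iff at least one of the values of $\varphi$ or $\psi$ in this expression is undefined. Partial transformations of $X^*$ arising in this way are called (partial) automatic transformations. Such a transformation is finitary if there is $l\ge 0$ such that for every word $x_1x_2\dots$ in its domain, with image $y_1y_2\dots$, one has $x_i=y_i$ for all $i\ge l$. $Fin\mathcal{PA}(X)$ is the semigroup (under composition) of all partial finitary automatic transformations of $X^*$ (not necessarily injective), $Fin\mathcal{A}(X)$ is the semigroup of all everywhere defined ones, and $Fin\mathcal{SA}(X)$ is the group of all everywhere defined injective ones. In $S$ every element $f$ has a power lying in a subgroup of $S$; $e_f$ denotes the identity element of the group $H_{f^t}$ (the $\mathcal{H}$-class of $f^t$ in $S$ for Green's relation $\mathcal{H}$), where $t\ge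 1$ is such that $H_{f^t}$ is a group; this does not depend on $t$. The element $fe_f$ lies in a subgroup of $S$. For an element $\pi$ lying in a subgroup of $S$, $\overline{\pi}$ denotes the restriction of $\pi$ to its range $\mathrm{ran}\,\pi$, a partial injective finitary automatic transformation permuting $\mathrm{ran}\,\pi$. In a semigroup $S$ write $a\sim_p b$ if $a=xy$, $b=yx$ for some $x,y\in S$; $a,b$ are $S$-conjugate if they are related by the transitive closure of $\sim_p$. Partial injective finitary automatic transformations $a,b$ are $Fin\mathcal{SA}(X)$-conjugate if $a=h^{-1}bh$ for some $h\in Fin\mathcal{SA}(X)$. *)

theory Defs
  imports "HOL-Algebra.Group"
begin

text \<open>The alphabet is a finite type \<open>'a\<close>, and words are lists. Partial transformations
  of the set of words have type \<open>'a list \<rightharpoonup> 'a list\<close>.\<close>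

record ('s, 'a) automaton =
  states :: "'s set"
  trans :: "'s \<times> 'a \<rightharpoonup> 's"
  outp :: "'s \<times> 'a \<rightharpoonup> 'a"
  init :: 's

definition wf_automaton :: "('s, 'a) automaton \<Rightarrow> bool" where
  "wf_automaton A \<longleftrightarrow> init A \<in> states A \<and>
     dom (trans A) \<subseteq> states A \<times> UNIV \<and> ran (trans A) \<subseteq> states A \<and>
     dom (outp A) \<subseteq> states A \<times> UNIV"

definition run :: "('s, 'a) automaton \<Rightarrow> 's \<Rightarrow> 'a list \<Rightarrow> 's option" where
  "run A q w = foldl (\<lambda>r x. Option.bind r (\<lambda>p. trans A (p, x))) (Some q) w"

lemma run_Nil [simp]: "run A q [] = Some q"
  by (simp add: run_def)

lemma run_snoc [simp]: "run A q (w @ [x]) = Option.bind (run A q w) (\<lambda>p. trans A (p, x))"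
  by (simp add: run_def)

text \<open>The transition on the last letter of \<open>u\<close> is not consulted, so it may be undefined.\<close>

definition transf :: "('s, 'a) automaton \<Rightarrow> ('a list \<rightharpoonup> 'a list)" where
  "transf A u = those (map (\<lambda>i. Option.bind (run A (init A) (take i u))
                                 (\<lambda>p. outp A (p, u ! i))) [0..<length u])"

text \<open>State sets may be infinite. Taking states in \<open>'a list\<close> loses no generality:
  see \<open>automatic_transf\<close> below.\<close>

definition automatic :: "('a list \<rightharpoonup> 'a list) \<Rightarrow> bool" where
  "automatic f \<longleftrightarrow> (\<exists>A :: ('a list, 'a) automaton. wf_automaton A \<and> transf A = f)"

lemma automatic_transf:
  fixes A :: "('s, 'a) automaton"
  shows "automatic (transf A)"
proof -
  define B :: "('a list, 'a) automaton" where
    "B = \<lparr>states = UNIV,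
          trans = (\<lambda>(w, x). map_option (\<lambda>_. w @ [x]) (run A (init A) (w @ [x]))),
          outp = (\<lambda>(w, x). Option.bind (run A (init A) w) (\<lambda>p. outp A (p, x))),
          init = []\<rparr>"
  have run_B: "run B [] w = map_option (\<lambda>_. w) (run A (init A) w)" for w
  proof (induction w rule: rev_induct)
    case (snoc x w)
    then show ?case
      by (cases "run A (init A) w") (simp_all add: B_def)
  qed simp
  have "init B = []" by (simp add: B_def)
  have "Option.bind (run B (init B) w) (\<lambda>p. outp B (p, x)) =
        Option.bind (run A (init A) w) (\<lambda>p. outp A (p, x))" for w x
    unfolding \<open>init B = []\<close> run_B by (cases "run A (init A) w") (simp_all add: B_def)
  then have "transf B = transf A"
    unfolding transf_def by (intro ext) (simp del: map_eq_conv)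
  moreover have "wf_automaton B"
    by (auto simp: wf_automaton_def B_def)
  ultimately show ?thesis
    unfolding automatic_def by blast
qed

text \<open>Positions are counted from 0 here; the shift is absorbed by the choice of \<open>l\<close>.\<close>

definition finitary :: "('a list \<rightharpoonup> 'a list) \<Rightarrow> bool" where
  "finitary f \<longleftrightarrow> (\<exists>l. \<forall>u v. f u = Some v \<longrightarrow> (\<forall>i. l \<le> i \<and> i < length u \<longrightarrow> u ! i = v ! i))"

text \<open>Products are read from left to right: \<open>f \<otimes> g\<close> applies \<open>f\<close> first.\<close>

definition FinPA :: "('a::finite list \<rightharpoonup> 'a list) monoid" where
  "FinPA = \<lparr>carrier = {f. automatic f \<and> finitary f}, monoid.mult = (\<lambda>f g. g \<circ>\<^sub>m f), one = Some\<rparr>"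

definition FinA :: "('a::finite list \<rightharpoonup> 'a list) monoid" where
  "FinA = FinPA\<lparr>carrier := {f \<in> carrier FinPA. dom f = UNIV}\<rparr>"

definition FinSA :: "('a::finite list \<rightharpoonup> 'a list) monoid" where
  "FinSA = FinPA\<lparr>carrier := {f \<in> carrier FinPA. dom f = UNIV \<and> inj f}\<rparr>"

text \<open>Green's relations are only needed for monoids, where adjoining an identity is superfluous.\<close>

definition green_L :: "('s, 'm) monoid_scheme \<Rightarrow> 's \<Rightarrow> 's \<Rightarrow> bool" where
  "green_L S a b \<longleftrightarrow> {s \<otimes>\<^bsub>S\<^esub> a | s. s \<in> carrier S} = {s \<otimes>\<^bsub>S\<^esub> b | s. s \<in> carrier S}"

definition green_R :: "('s, 'm) monoid_scheme \<Rightarrow> 's \<Rightarrow> 's \<Rightarrow> bool" where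
  "green_R S a b \<longleftrightarrow> {a \<otimes>\<^bsub>S\<^esub> s | s. s \<in> carrier S} = {b \<otimes>\<^bsub>S\<^esub> s | s. s \<in> carrier S}"

definition H_class :: "('s, 'm) monoid_scheme \<Rightarrow> 's \<Rightarrow> 's set" where
  "H_class S a = {b \<in> carrier S. green_L S a b \<and> green_R S a b}"

definition idem_of :: "('s, 'm) monoid_scheme \<Rightarrow> 's \<Rightarrow> 's" where
  "idem_of S f = (THE e. \<exists>t::nat. t \<ge> 1 \<and>
     group \<lparr>carrier = H_class S (f [^]\<^bsub>S\<^esub> t), monoid.mult = monoid.mult S, one = e\<rparr>)"

definition p_conj :: "('s, 'm) monoid_scheme \<Rightarrow> 's \<Rightarrow> 's \<Rightarrow> bool" where
  "p_conj S a b \<longleftrightarrow> (\<exists>x\<in>carrier S. \<exists>y\<in>carrier S. a = x \<otimes>\<^bsub>S\<^esub> y \<and> b = y \<otimes>\<^bsub>S\<^esub> x)"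

definition S_conj :: "('s, 'm) monoid_scheme \<Rightarrow> 's \<Rightarrow> 's \<Rightarrow> bool" where
  "S_conj S = (p_conj S)\<^sup>+\<^sup>+"

definition restrict_ran :: "('b \<rightharpoonup> 'b) \<Rightarrow> ('b \<rightharpoonup> 'b)" where
  "restrict_ran p = p |` ran p"

definition FinSA_conj :: "('a::finite list \<rightharpoonup> 'a list) \<Rightarrow> ('a list \<rightharpoonup> 'a list) \<Rightarrow> bool" where
  "FinSA_conj a b \<longleftrightarrow>
     (\<exists>h\<in>carrier FinSA. a = inv\<^bsub>FinSA\<^esub> h \<otimes>\<^bsub>FinPA\<^esub> b \<otimes>\<^bsub>FinPA\<^esub> h)"

end

theory Submission
  imports Defs
begin

text \<open>
  Words form a rooted tree, and an automatic transformation is a partial, level-preserving map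
  that respects the relation between a word and its one-letter extensions (\<open>automatic_iff\<close>). Its
  range is therefore a subtree. Being finitary means that from some level on the last letter is
  copied.

  Some power \<open>e = f\<^sup>t\<close>, \<open>t \<ge> 1\<close>, is idempotent, although the semigroup \<open>S\<close> is infinite: an orbit
  of \<open>f\<close> only changes a prefix of bounded length, so the sizes of the orbits are bounded
  (\<open>idempotent_power\<close>). The identity of the group \<open>\<H>\<close>-class is this \<open>e\<close>, and the restriction of
  \<open>f e\<close> to its range is the permutation that \<open>f\<close> induces on the subtree \<open>ran e\<close> of words
  surviving all powers of \<open>f\<close> (\<open>core_eq\<close>); call it the core of \<open>f\<close>.

  Conjugate elements have conjugate cores. If \<open>f = x y\<close> and \<open>g = y x\<close>, with idempotent powers
  \<open>e\<close> and \<open>d\<close>, then \<open>x\<close> maps \<open>ran e\<close> bijectively onto \<open>ran d\<close> and intertwines \<open>f\<close> and \<open>g\<close> there.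
  A partial injective finitary tree map extends to a finitary tree automorphism, because at every
  vertex an injection between two sets of letters extends to a permutation of the alphabet
  (\<open>injective_extends_FinSA\<close>). The extension of the restriction of \<open>x\<close> conjugates the cores.

  Conversely, \<open>S\<close> contains an idempotent \<open>r\<close> with range \<open>ran f\<close> that fixes \<open>ran f\<close> pointwise. As
  \<open>f = f r\<close>, the element \<open>f\<close> is conjugate to \<open>r f\<close>, whose range is \<open>ran (f\<^sup>2)\<close>. Iterating this
  shrinks the range to \<open>ran e\<close> and shows that \<open>f\<close> is conjugate to \<open>f e\<close> (\<open>S_conj_core\<close>); note
  that \<open>f\<close> need not be regular, so one cannot argue with inverses. Finally an automorphism \<open>h\<close>
  conjugating the cores of \<open>f\<close> and \<open>g\<close> gives \<open>f e = x y\<close> and \<open>g d = y x\<close> with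
  \<open>x = e h\<close> and \<open>y = d h\<^sup>-\<^sup>1 f e\<close>.

  Products in this overview are read from left to right, whereas the operator \<open>\<circ>\<^sub>m\<close> used below
  composes from right to left.
\<close>

section \<open>Automatic transformations as tree maps\<close>

lemma those_snoc: "those (xs @ [x]) = Option.bind (those xs) (\<lambda>ys. map_option (\<lambda>y. ys @ [y]) x)"
  by (induction xs) (auto split: option.splits bind_splits simp: option.map_comp comp_def)

lemma transf_snoc:
  "transf A (u @ [x]) = Option.bind (transf A u)
     (\<lambda>v. map_option (\<lambda>y. v @ [y]) (Option.bind (run A (init A) u) (\<lambda>p. outp A (p, x))))"
proof -
  have "map (\<lambda>i. Option.bind (run A (init A) (take i (u @ [x]))) (\<lambda>p. outp A (p, (u @ [x]) ! i))) [0..<length u]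
      = map (\<lambda>i. Option.bind (run A (init A) (take i u)) (\<lambda>p. outp A (p, u ! i))) [0..<length u]"
    by (simp add: nth_append)
  then show ?thesis
    unfolding transf_def by (simp add: those_snoc del: map_eq_conv)
qed

text \<open>For the converse the words themselves serve as states: the automaton remembers its input \<open>w\<close>
  and, on reading \<open>x\<close>, outputs the last letter of \<open>f (w @ [x])\<close>.\<close>

lemma automatic_iff:
  "automatic f \<longleftrightarrow> f [] = Some [] \<and>
     (\<forall>u x w. f (u @ [x]) = Some w \<longrightarrow> (\<exists>v y. f u = Some v \<and> w = v @ [y]))" (is "_ \<longleftrightarrow> ?R")
proof
  assume "automatic f"
  then obtain A :: "('a list, 'a) automaton" where A: "f = transf A"
    by (auto simp: automatic_def)
  show ?R
    unfolding A by (auto simp: transf_snoc bind_eq_Some_conv) (simp add: transf_def)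
next
  assume R: ?R
  define A :: "('a list, 'a) automaton" where
    "A = \<lparr>states = UNIV, trans = (\<lambda>(w, x). Some (w @ [x])),
          outp = (\<lambda>(w, x). map_option last (f (w @ [x]))), init = []\<rparr>"
  have run: "run A [] w = Some w" for w
    by (induction w rule: rev_induct) (simp_all add: A_def)
  have "transf A u = f u" for u
  proof (induction u rule: rev_induct)
    case Nil
    then show ?case using R by (simp add: transf_def)
  next
    case (snoc x u)
    have init: "init A = []" by (simp add: A_def)
    show ?case
    proof (cases "f (u @ [x])")
      case None
      then show ?thesis
        unfolding transf_snoc snoc init run by (cases "f u") (simp_all add: A_def)
    next
      case (Some w)
      with R obtain v y where "f u = Some v" "w = v @ [y]" by blast
      with Some show ?thesis
        unfolding transf_snoc snoc init run by (simp add: A_def)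
    qed
  qed
  then have "transf A = f" by auto
  with automatic_transf[of A] show "automatic f" by simp
qed

lemma automatic_length:
  assumes "automatic f" "f u = Some v"
  shows "length v = length u"
  using assms(2)
proof (induction u arbitrary: v rule: rev_induct)
  case Nil
  then show ?case using assms(1) by (simp add: automatic_iff)
next
  case (snoc x u)
  then show ?case using assms(1) unfolding automatic_iff by fastforce
qed

lemma automatic_take:
  assumes "automatic f" "f u = Some v"
  shows "f (take n u) = Some (take n v)"
  using assms(2)
proof (induction u arbitrary: v rule: rev_induct)
  case Nil
  then show ?case using assms(1) by (auto simp: automatic_iff)
next
  case (snoc x u)
  then obtain v' y where v: "f u = Some v'" "v = v' @ [y]"
    using assms(1) unfolding automatic_iff by blast
  have "length v = length (u @ [x])"
    using automatic_length[OF assms(1) snoc.prems] .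
  then show ?case
    using snoc.IH[OF v(1)] snoc.prems v by (cases "n \<le> length u") auto
qed

lemma finitary_iff:
  assumes "automatic f"
  shows "finitary f \<longleftrightarrow> (\<exists>l. \<forall>u x v y. f (u @ [x]) = Some (v @ [y]) \<longrightarrow> l \<le> length u \<longrightarrow> x = y)"
proof
  assume "finitary f"
  then obtain l where l: "\<And>u v i. f u = Some v \<Longrightarrow> l \<le> i \<Longrightarrow> i < length u \<Longrightarrow> u ! i = v ! i"
    unfolding finitary_def by blast
  have "x = y" if "f (u @ [x]) = Some (v @ [y])" "l \<le> length u" for u x v y
    using l[OF that(1), of "length u"] that(2) automatic_length[OF assms that(1)]
    by (metis length_append_singleton lessI nat.inject nth_append_length)
  then show "\<exists>l. \<forall>u x v y. f (u @ [x]) = Some (v @ [y]) \<longrightarrow> l \<le> length u \<longrightarrow> x = y" by blast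
next
  assume "\<exists>l. \<forall>u x v y. f (u @ [x]) = Some (v @ [y]) \<longrightarrow> l \<le> length u \<longrightarrow> x = y"
  then obtain l where l: "\<And>u x v y. f (u @ [x]) = Some (v @ [y]) \<Longrightarrow> l \<le> length u \<Longrightarrow> x = y"
    by blast
  have "u ! i = v ! i" if "f u = Some v" "l \<le> i" "i < length u" for u v i
  proof -
    have "length v = length u" using automatic_length[OF assms that(1)] .
    then have "f (take i u @ [u ! i]) = Some (take i v @ [v ! i])"
      using automatic_take[OF assms that(1), of "Suc i"] that(3) by (simp add: take_Suc_conv_app_nth)
    then show ?thesis using l that by simp
  qed
  then show "finitary f" unfolding finitary_def by blast
qed

text \<open>Without automata and positions inside words, membership can be checked one letter at a time;
  the closure under composition, inversion and restriction is verified in this form.\<close>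

lemma FinPA_iff:
  "f \<in> carrier FinPA \<longleftrightarrow> f [] = Some [] \<and>
     (\<forall>u x w. f (u @ [x]) = Some w \<longrightarrow> (\<exists>v y. f u = Some v \<and> w = v @ [y])) \<and>
     (\<exists>l. \<forall>u x v y. f (u @ [x]) = Some (v @ [y]) \<longrightarrow> l \<le> length u \<longrightarrow> x = y)"
  using finitary_iff[of f] automatic_iff[of f] by (auto simp: FinPA_def)

lemma FinPA_Nil: "f \<in> carrier FinPA \<Longrightarrow> f [] = Some []"
  by (simp add: FinPA_iff)

lemma FinPA_snocE:
  assumes "f \<in> carrier FinPA" "f (u @ [x]) = Some w"
  obtains v y where "f u = Some v" "w = v @ [y]"
  using assms unfolding FinPA_iff by blast

lemma FinPA_level:
  assumes "f \<in> carrier FinPA"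
  obtains l where "\<And>u x v y. f (u @ [x]) = Some (v @ [y]) \<Longrightarrow> l \<le> length u \<Longrightarrow> x = y"
  using assms unfolding FinPA_iff by blast

lemma FinPA_length: "f \<in> carrier FinPA \<Longrightarrow> f u = Some v \<Longrightarrow> length v = length u"
  by (auto simp: FinPA_def intro: automatic_length)

lemma FinPA_drop:
  assumes f: "f \<in> carrier FinPA"
  obtains l where "\<And>u v. f u = Some v \<Longrightarrow> drop l v = drop l u"
proof -
  from f obtain l where
    l: "\<And>u v i. f u = Some v \<Longrightarrow> l \<le> i \<Longrightarrow> i < length u \<Longrightarrow> u ! i = v ! i"
    unfolding FinPA_def finitary_def by auto
  have "drop l v = drop l u" if "f u = Some v" for u v
    using l[OF that] FinPA_length[OF f that] by (intro nth_equalityI) auto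
  then show thesis by (rule that)
qed

lemma FinPA_ran_snocE:
  assumes f: "f \<in> carrier FinPA" and "v @ [y] \<in> ran f"
  obtains u x where "f (u @ [x]) = Some (v @ [y])" "f u = Some v"
proof -
  from assms obtain w where w: "f w = Some (v @ [y])" by (auto simp: ran_def)
  with f have "w \<noteq> []" by (auto simp: FinPA_Nil)
  then obtain u x where "w = u @ [x]" by (metis rev_exhaust)
  with w f show thesis by (auto elim!: FinPA_snocE intro: that)
qed

section \<open>The monoids of finitary transformations and the automorphism group\<close>

lemma FinPA_simps [simp]:
  "f \<otimes>\<^bsub>FinPA\<^esub> g = g \<circ>\<^sub>m f" "\<one>\<^bsub>FinPA\<^esub> = Some"
  by (simp_all add: FinPA_def)

lemma FinA_simps [simp]:
  "f \<otimes>\<^bsub>FinA\<^esub> g = g \<circ>\<^sub>m f" "\<one>\<^bsub>FinA\<^esub> = Some"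
  "f \<in> carrier FinA \<longleftrightarrow> f \<in> carrier FinPA \<and> dom f = UNIV"
  by (simp_all add: FinA_def FinPA_def)

lemma FinSA_simps [simp]:
  "f \<otimes>\<^bsub>FinSA\<^esub> g = g \<circ>\<^sub>m f" "\<one>\<^bsub>FinSA\<^esub> = Some"
  "f \<in> carrier FinSA \<longleftrightarrow> f \<in> carrier FinPA \<and> dom f = UNIV \<and> inj f"
  by (simp_all add: FinSA_def FinPA_def)

lemma map_comp_assoc_rev: "h \<circ>\<^sub>m (g \<circ>\<^sub>m f) = (h \<circ>\<^sub>m g) \<circ>\<^sub>m f"
  by (auto simp: map_comp_def fun_eq_iff split: option.splits)

lemma map_comp_Some [simp]: "f \<circ>\<^sub>m Some = f" "Some \<circ>\<^sub>m f = f"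
  by (auto simp: map_comp_def fun_eq_iff split: option.splits)

lemma drop_eq_mono: "drop l v = drop l u \<Longrightarrow> l \<le> m \<Longrightarrow> drop m v = drop m u"
  by (metis drop_drop le_add_diff_inverse2)

lemma FinPA_comp:
  assumes f: "f \<in> carrier FinPA" and g: "g \<in> carrier FinPA"
  shows "g \<circ>\<^sub>m f \<in> carrier FinPA"
proof -
  obtain k where k: "\<And>u v. f u = Some v \<Longrightarrow> drop k v = drop k u" using FinPA_drop[OF f] by blast
  obtain l where l: "\<And>u v. g u = Some v \<Longrightarrow> drop l v = drop l u" using FinPA_drop[OF g] by blast
  have snoc: "\<exists>v y. (g \<circ>\<^sub>m f) u = Some v \<and> w = v @ [y]" if "(g \<circ>\<^sub>m f) (u @ [x]) = Some w" for u x w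
    using that f g by (auto simp: map_comp_Some_iff elim!: FinPA_snocE)
  have "x = y" if vy: "(g \<circ>\<^sub>m f) (u @ [x]) = Some (v @ [y])" and len: "max k l \<le> length u" for u x v y
  proof -
    from vy obtain w where w: "f (u @ [x]) = Some w" "g w = Some (v @ [y])"
      by (auto simp: map_comp_Some_iff)
    have lens: "length w = Suc (length u)" "length v = length u"
      using FinPA_length[OF f w(1)] FinPA_length[OF g w(2)] by auto
    have "drop (max k l) (v @ [y]) = drop (max k l) (u @ [x])"
      using drop_eq_mono[OF k[OF w(1)], of "max k l"] drop_eq_mono[OF l[OF w(2)], of "max k l"] by simp
    then show ?thesis using len lens by simp
  qed
  then show ?thesis
    unfolding FinPA_iff using snoc f g by (auto simp: FinPA_Nil map_comp_def intro: exI[of _ "max k l"])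
qed

lemma Some_FinPA: "Some \<in> carrier FinPA"
  by (auto simp: FinPA_iff)

lemma dom_map_comp_UNIV: "dom f = UNIV \<Longrightarrow> dom g = UNIV \<Longrightarrow> dom (g \<circ>\<^sub>m f) = UNIV"
  by (auto simp: dom_def map_comp_def set_eq_iff split: option.splits) 

lemma monoid_FinPA: "monoid FinPA"
  by (rule monoidI) (auto simp: FinPA_comp Some_FinPA map_comp_assoc_rev)

lemma monoid_FinA: "monoid FinA"
  by (rule monoidI) (auto simp: FinPA_comp Some_FinPA map_comp_assoc_rev dom_map_comp_UNIV)

text \<open>An injective map on the finite set of words of a given length is surjective.\<close>

lemma FinSA_surj:
  assumes h: "h \<in> carrier FinSA"
  shows "\<exists>u. h u = Some w"
proof -
  have h': "h \<in> carrier FinPA" "dom h = UNIV" "inj h" using h by auto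
  have Some: "h u = Some (the (h u))" for u using h'(2) by (metis UNIV_I domD option.sel)
  let ?W = "{u :: 'a list. length u = length w}"
  have "finite ?W" using finite_lists_length_eq[of "UNIV :: 'a set" "length w"] by simp
  moreover have "(\<lambda>u. the (h u)) ` ?W \<subseteq> ?W"
    using FinPA_length[OF h'(1)] Some by auto
  moreover have "inj_on (\<lambda>u. the (h u)) ?W"
    by (metis (mono_tags, lifting) Some h'(3) injD inj_onI)
  ultimately have "(\<lambda>u. the (h u)) ` ?W = ?W" by (rule endo_inj_surj)
  then have "w \<in> (\<lambda>u. the (h u)) ` ?W" by auto
  then show ?thesis using Some by (metis (no_types, lifting) imageE)
qed

lemma FinSA_inverse:
  assumes h: "h \<in> carrier FinSA"
  obtains k where "k \<in> carrier FinSA" "h \<circ>\<^sub>m k = Some" "k \<circ>\<^sub>m h = Some"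
proof -
  have h': "h \<in> carrier FinPA" "dom h = UNIV" "inj h" using h by auto
  define k where "k = (\<lambda>w. Some (inv_into UNIV h (Some w)))"
  have k: "k w = Some u \<longleftrightarrow> h u = Some w" for u w
    using FinSA_surj[OF h, of w] h'(3) by (auto simp: k_def inv_f_eq intro: injD)
  obtain l where l: "\<And>u x v y. h (u @ [x]) = Some (v @ [y]) \<Longrightarrow> l \<le> length u \<Longrightarrow> x = y"
    using FinPA_level[OF h'(1)] by metis
  have snoc: "\<exists>v y. k u = Some v \<and> w = v @ [y]" if "k (u @ [x]) = Some w" for u x w
    using that unfolding k by (metis FinPA_ran_snocE[OF h'(1)] h'(3) injD ranI)
  have lev: "x = y" if "k (u @ [x]) = Some (v @ [y])" "l \<le> length u" for u x v y
    using that l FinPA_length[OF h'(1)] unfolding k by fastforce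
  have "k [] = Some []" unfolding k using h'(1) by (simp add: FinPA_Nil)
  then have "k \<in> carrier FinPA" unfolding FinPA_iff using snoc lev by blast
  moreover have "dom k = UNIV" by (auto simp: k_def)
  moreover have "inj k"
    by (metis (no_types, lifting) injI k k_def option.inject)
  moreover have "(h \<circ>\<^sub>m k) w = Some w" for w
    using k[of w "inv_into UNIV h (Some w)"] by (simp add: k_def map_comp_def)
  moreover have "(k \<circ>\<^sub>m h) w = Some w" for w
  proof -
    obtain v where "h w = Some v" using h'(2) by (metis UNIV_I domD)
    then show ?thesis using k by (simp add: map_comp_def)
  qed
  ultimately show thesis by (intro that[of k]) (auto simp: fun_eq_iff)
qed

lemma inj_map_comp: "inj f \<Longrightarrow> inj g \<Longrightarrow> dom f = UNIV \<Longrightarrow> dom g = UNIV \<Longrightarrow> inj (g \<circ>\<^sub>m f)"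
  by (smt (verit, best) UNIV_I domD inj_def map_comp_simps(2) option.inject)

lemma group_FinSA: "group FinSA"
proof (rule groupI)
  fix h :: "'a list \<rightharpoonup> 'a list" assume "h \<in> carrier FinSA"
  then obtain k where "k \<in> carrier FinSA" "h \<circ>\<^sub>m k = Some"
    using FinSA_inverse by blast
  then show "\<exists>k\<in>carrier FinSA. k \<otimes>\<^bsub>FinSA\<^esub> h = \<one>\<^bsub>FinSA\<^esub>"
    by (metis FinSA_simps(1,2))
qed (auto simp: FinPA_comp Some_FinPA map_comp_assoc_rev dom_map_comp_UNIV inj_map_comp)

text \<open>Intertwining is easier to compose than the form with the inverse; the intertwiner here is the
  inverse of the element \<open>h\<close> in the definition.\<close>

lemma FinSA_conj_iff:
  "FinSA_conj a b \<longleftrightarrow> (\<exists>h\<in>carrier FinSA. h \<circ>\<^sub>m a = b \<circ>\<^sub>m h)"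
proof
  interpret group FinSA by (rule group_FinSA)
  assume "FinSA_conj a b"
  then obtain h where h: "h \<in> carrier FinSA"
    and a: "a = (h \<circ>\<^sub>m b) \<circ>\<^sub>m (inv\<^bsub>FinSA\<^esub> h)"
    by (auto simp: FinSA_conj_def map_comp_assoc_rev)
  have "(inv\<^bsub>FinSA\<^esub> h) \<circ>\<^sub>m h = Some" using r_inv[OF h] by simp
  then have "(inv\<^bsub>FinSA\<^esub> h) \<circ>\<^sub>m a = b \<circ>\<^sub>m (inv\<^bsub>FinSA\<^esub> h)"
    unfolding a map_comp_assoc_rev by simp
  with h show "\<exists>h\<in>carrier FinSA. h \<circ>\<^sub>m a = b \<circ>\<^sub>m h" using inv_closed by blast
next
  interpret group FinSA by (rule group_FinSA)
  assume "\<exists>h\<in>carrier FinSA. h \<circ>\<^sub>m a = b \<circ>\<^sub>m h"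
  then obtain h where h: "h \<in> carrier FinSA" and eq: "h \<circ>\<^sub>m a = b \<circ>\<^sub>m h" by blast
  have "inv\<^bsub>FinSA\<^esub> h \<circ>\<^sub>m h = Some" using r_inv[OF h] by simp
  then have "a = inv\<^bsub>FinSA\<^esub> h \<circ>\<^sub>m (b \<circ>\<^sub>m h)"
    unfolding eq[symmetric] map_comp_assoc_rev by simp
  then have "a = inv\<^bsub>FinSA\<^esub> (inv\<^bsub>FinSA\<^esub> h) \<otimes>\<^bsub>FinPA\<^esub> b \<otimes>\<^bsub>FinPA\<^esub> (inv\<^bsub>FinSA\<^esub> h)"
    using inv_inv[OF h] by simp
  then show "FinSA_conj a b" unfolding FinSA_conj_def using inv_closed[OF h] by blast
qed

lemma FinSA_conj_trans:
  assumes "FinSA_conj a b" "FinSA_conj b c"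
  shows "FinSA_conj a c"
proof -
  from assms obtain h k where h: "h \<in> carrier FinSA" "h \<circ>\<^sub>m a = b \<circ>\<^sub>m h"
    and k: "k \<in> carrier FinSA" "k \<circ>\<^sub>m b = c \<circ>\<^sub>m k"
    unfolding FinSA_conj_iff by blast
  have "k \<circ>\<^sub>m h \<in> carrier FinSA"
    using monoid.m_closed[OF group.is_monoid[OF group_FinSA] h(1) k(1)] by simp
  moreover have "(k \<circ>\<^sub>m h) \<circ>\<^sub>m a = c \<circ>\<^sub>m (k \<circ>\<^sub>m h)"
    by (metis h(2) k(2) map_comp_assoc_rev)
  ultimately show ?thesis unfolding FinSA_conj_iff by blast
qed

section \<open>Idempotent powers and maximal subgroups\<close>

text \<open>The classical fact that the \<open>\<H>\<close>-class of an idempotent \<open>e\<close> is the group of units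
  of the local monoid \<open>e G e\<close>: if \<open>s a = e = a s'\<close> then \<open>e s e\<close> is a two-sided inverse of \<open>a\<close> there.\<close>

lemma (in monoid) H_class_idem:
  assumes e: "e \<in> carrier G" "e \<otimes> e = e"
  shows "H_class G e = {a \<in> carrier G. e \<otimes> a = a \<and> a \<otimes> e = a \<and>
    (\<exists>b\<in>carrier G. e \<otimes> b = b \<and> b \<otimes> e = b \<and> a \<otimes> b = e \<and> b \<otimes> a = e)}" (is "_ = ?U")
proof (intro equalityI subsetI)
  fix a assume "a \<in> H_class G e"
  then have a: "a \<in> carrier G"
    and L: "{s \<otimes> e | s. s \<in> carrier G} = {s \<otimes> a | s. s \<in> carrier G}"
    and R: "{e \<otimes> s | s. s \<in> carrier G} = {a \<otimes> s | s. s \<in> carrier G}"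
    by (auto simp: H_class_def green_L_def green_R_def)
  have "a \<in> {s \<otimes> e | s. s \<in> carrier G}"
    unfolding L using a l_one[OF a, symmetric] by blast
  then obtain p where p: "p \<in> carrier G" "a = p \<otimes> e" by blast
  have "a \<in> {e \<otimes> s | s. s \<in> carrier G}"
    unfolding R using a r_one[OF a, symmetric] by blast
  then obtain q where q: "q \<in> carrier G" "a = e \<otimes> q" by blast
  have ae: "a \<otimes> e = a" using p e by (simp add: m_assoc)
  have ea: "e \<otimes> a = a" using q e by (simp flip: m_assoc)
  have "e \<in> {s \<otimes> a | s. s \<in> carrier G}"
    unfolding L[symmetric] using e(1) l_one[OF e(1), symmetric] by blast
  then obtain s where s: "s \<in> carrier G" "s \<otimes> a = e" by force
  have "e \<in> {a \<otimes> s | s. s \<in> carrier G}"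
    unfolding R[symmetric] using e(1) r_one[OF e(1), symmetric] by blast
  then obtain s' where s': "s' \<in> carrier G" "a \<otimes> s' = e" by force
  define b where "b = e \<otimes> s \<otimes> e"
  have b: "b \<in> carrier G" using e s by (simp add: b_def)
  have "b \<otimes> a = e \<otimes> (s \<otimes> (e \<otimes> a))" using a e s by (simp add: b_def m_assoc)
  then have ba: "b \<otimes> a = e" using ea s e by simp
  have "a \<otimes> (b \<otimes> (a \<otimes> s')) = (a \<otimes> (b \<otimes> a)) \<otimes> s'" using a b s' by (simp add: m_assoc)
  moreover have "b \<otimes> e = b" using e s by (simp add: b_def m_assoc)
  ultimately have ab: "a \<otimes> b = e" using ba ae s' by simp
  have "e \<otimes> b = b" using e s by (simp add: b_def flip: m_assoc)
  with \<open>b \<otimes> e = b\<close> a b ab ba ae ea show "a \<in> ?U" by blast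
next
  fix a assume "a \<in> ?U"
  then obtain b where a: "a \<in> carrier G" "e \<otimes> a = a" "a \<otimes> e = a"
    and b: "b \<in> carrier G" "a \<otimes> b = e" "b \<otimes> a = e" by blast
  have "\<exists>s'. s \<otimes> e = s' \<otimes> a \<and> s' \<in> carrier G" if "s \<in> carrier G" for s
    using that a b by (intro exI[of _ "s \<otimes> b"]) (simp add: m_assoc)
  moreover have "\<exists>s'. s \<otimes> a = s' \<otimes> e \<and> s' \<in> carrier G" if "s \<in> carrier G" for s
    using that a e by (intro exI[of _ "s \<otimes> a"]) (simp add: m_assoc)
  moreover have "\<exists>s'. e \<otimes> s = a \<otimes> s' \<and> s' \<in> carrier G" if "s \<in> carrier G" for s
    using that a b by (intro exI[of _ "b \<otimes> s"]) (simp flip: m_assoc)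
  moreover have "\<exists>s'. a \<otimes> s = e \<otimes> s' \<and> s' \<in> carrier G" if "s \<in> carrier G" for s
    using that a e by (intro exI[of _ "a \<otimes> s"]) (simp flip: m_assoc)
  ultimately have "green_L G e a" "green_R G e a"
    unfolding green_L_def green_R_def by blast+
  with a show "a \<in> H_class G e" by (simp add: H_class_def)
qed

lemma (in monoid) group_H_class_idem:
  assumes e: "e \<in> carrier G" "e \<otimes> e = e"
  shows "group \<lparr>carrier = H_class G e, monoid.mult = monoid.mult G, one = e\<rparr>"
proof -
  have closed: "a \<otimes> a' \<in> H_class G e" if "a \<in> H_class G e" "a' \<in> H_class G e" for a a'
  proof -
    from that obtain b b' where
      a: "a \<in> carrier G" "e \<otimes> a = a" "a \<otimes> e = a" and
      b: "b \<in> carrier G" "e \<otimes> b = b" "b \<otimes> e = b" "a \<otimes> b = e" "b \<otimes> a = e" and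
      a': "a' \<in> carrier G" "e \<otimes> a' = a'" "a' \<otimes> e = a'" and
      b': "b' \<in> carrier G" "e \<otimes> b' = b'" "b' \<otimes> e = b'" "a' \<otimes> b' = e" "b' \<otimes> a' = e"
      unfolding H_class_idem[OF e] by blast
    have "(a \<otimes> a') \<otimes> (b' \<otimes> b) = a \<otimes> (a' \<otimes> b') \<otimes> b" using a(1) b(1) a'(1) b'(1) by (simp add: m_assoc)
    then have 1: "(a \<otimes> a') \<otimes> (b' \<otimes> b) = e" using a b b' by simp
    have "(b' \<otimes> b) \<otimes> (a \<otimes> a') = b' \<otimes> (b \<otimes> a) \<otimes> a'" using a(1) b(1) a'(1) b'(1) by (simp add: m_assoc)
    then have 2: "(b' \<otimes> b) \<otimes> (a \<otimes> a') = e" using b b' by simp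
    have 3: "e \<otimes> (a \<otimes> a') = a \<otimes> a'" "e \<otimes> (b' \<otimes> b) = b' \<otimes> b"
      using a a' b b' e by (simp_all flip: m_assoc)
    have 4: "(a \<otimes> a') \<otimes> e = a \<otimes> a'" "(b' \<otimes> b) \<otimes> e = b' \<otimes> b"
      using a a' b b' e by (simp_all add: m_assoc)
    show ?thesis
      unfolding H_class_idem[OF e] using 1 2 3 4 a a' b b' by blast
  qed
  have e_in: "e \<in> H_class G e"
    using e unfolding H_class_idem[OF e] by blast
  have inv: "\<exists>b\<in>H_class G e. b \<otimes> a = e" if "a \<in> H_class G e" for a
    using that unfolding H_class_idem[OF e] by blast
  show ?thesis
    by (rule groupI) (use closed e_in inv in \<open>auto simp: H_class_idem[OF e] m_assoc\<close>)
qed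

text \<open>Uniqueness: if the class of \<open>f [^] s\<close> is a group, it contains \<open>f [^] (s * t)\<close>, which equals
  the idempotent \<open>f [^] t\<close>, and the only idempotent of a group is its identity.\<close>

lemma (in monoid) idem_of_eq:
  fixes t :: nat
  assumes f: "f \<in> carrier G" and t: "1 \<le> t"
    and idem: "f [^] t \<otimes> f [^] t = f [^] t"
  shows "idem_of G f = f [^] t"
  unfolding idem_of_def
proof (rule the_equality)
  show "\<exists>s::nat. s \<ge> 1 \<and> group \<lparr>carrier = H_class G (f [^] s), monoid.mult = monoid.mult G, one = f [^] t\<rparr>"
    using group_H_class_idem[OF nat_pow_closed[OF f] idem] t by blast
next
  fix e
  assume "\<exists>s::nat. s \<ge> 1 \<and> group \<lparr>carrier = H_class G (f [^] s), monoid.mult = monoid.mult G, one = e\<rparr>"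
  then obtain s :: nat where s: "s \<ge> 1"
    and grp: "group \<lparr>carrier = H_class G (f [^] s), monoid.mult = monoid.mult G, one = e\<rparr>" (is "group ?H")
    by blast
  interpret H: group ?H by (rule grp)
  have c: "f [^] s \<in> H_class G (f [^] s)"
    using f by (simp add: H_class_def green_L_def green_R_def)
  have pow_H: "f [^] (s * Suc n) \<in> H_class G (f [^] s)" for n
  proof (induction n)
    case (Suc n)
    have "f [^] (s * Suc (Suc n)) = f [^] (s * Suc n) \<otimes> f [^] s"
      using f by (simp add: nat_pow_mult add.commute add.left_commute)
    then show ?case using H.m_closed[of "f [^] (s * Suc n)" "f [^] s"] Suc c by simp
  qed (use c in simp)
  have pow_t: "f [^] (t * Suc n) = f [^] t" for n
  proof (induction n)
    case (Suc n)
    have "f [^] (t * Suc (Suc n)) = f [^] (t * Suc n) \<otimes> f [^] t"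
      using f by (simp add: nat_pow_mult add.commute add.left_commute)
    then show ?case using Suc idem by simp
  qed simp
  have "f [^] (s * t) = f [^] t"
    using pow_t[of "s - 1"] s by (simp add: mult.commute)
  moreover have "f [^] (s * t) \<in> H_class G (f [^] s)"
    using pow_H[of "t - 1"] t by simp
  ultimately have "f [^] t \<in> carrier ?H" by simp
  moreover from this have "f [^] t \<otimes>\<^bsub>?H\<^esub> f [^] t = f [^] t"
    using idem by simp
  ultimately have "f [^] t = \<one>\<^bsub>?H\<^esub>"
    using H.l_cancel_one' H.r_cancel_one' by metis
  then show "e = f [^] t" by simp
qed

text \<open>By the pigeonhole principle the orbit of \<open>w\<close> enters a cycle after at most \<open>K\<close> steps, and the
  length of this cycle is at most \<open>K\<close>, hence divides \<open>fact K\<close>. The exponent depends on \<open>K\<close>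
  only, so one exponent serves all points at once.\<close>

lemma funpow_fact_idem:
  fixes F :: "'b \<Rightarrow> 'b"
  assumes B: "finite B" "card B \<le> K" "\<And>i. (F ^^ i) w \<in> B"
  shows "(F ^^ (fact K + fact K)) w = (F ^^ fact K) w"
proof -
  let ?o = "\<lambda>i. (F ^^ i) w"
  have "\<not> inj_on ?o {..K}"
  proof
    assume "inj_on ?o {..K}"
    then have "card {..K} \<le> card B"
      by (rule card_inj_on_le) (use B in auto)
    with B(2) show False by simp
  qed
  then obtain i j where ij: "i < j" "j \<le> K" "?o i = ?o j"
    unfolding inj_on_def by (metis atMost_iff linorder_neqE_nat)
  define p where "p = j - i"
  have step: "?o (n + p) = ?o n" if "i \<le> n" for n
  proof -
    have "?o (n + p) = (F ^^ (n - i)) (?o j)"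
      using that ij(1) funpow_add[of "n - i" j F] by (simp add: p_def)
    also have "\<dots> = ?o n"
      using that funpow_add[of "n - i" i F] by (simp flip: ij(3))
    finally show ?thesis .
  qed
  have "p dvd fact K"
    using ij by (intro dvd_fact) (auto simp: p_def)
  then obtain m where m: "(fact K :: nat) = m * p" by (metis dvd_def mult.commute)
  have "i \<le> fact K" using ij fact_ge_self[of K] by linarith
  then have "?o (fact K + m' * p) = ?o (fact K)" for m'
  proof (induction m')
    case (Suc m')
    then show ?case using step[of "fact K + m' * p"] by (simp add: ac_simps)
  qed simp
  then show ?thesis using m by metis
qed


lemma map_comp_bind: "(g \<circ>\<^sub>m f) x = Option.bind (f x) g"
  by (cases "f x") simp_all

lemma ran_map_comp_iff: "v \<in> ran (g \<circ>\<^sub>m f) \<longleftrightarrow> (\<exists>u\<in>ran f. g u = Some v)"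
  by (auto simp: ran_def map_comp_Some_iff)

lemma ran_map_comp_subset: "ran (g \<circ>\<^sub>m f) \<subseteq> ran g"
  by (auto simp: ran_map_comp_iff intro: ranI)

lemma idem_on_ran:
  assumes "e \<circ>\<^sub>m e = e" "w \<in> ran e"
  shows "e w = Some w"
proof -
  from assms(2) obtain u where "e u = Some w" by (auto simp: ran_def)
  then show ?thesis using fun_cong[OF assms(1), of u] by simp
qed

lemma FinPA_restrict_ran:
  assumes f: "f \<in> carrier FinPA" and g: "g \<in> carrier FinPA"
  shows "f |` ran g \<in> carrier FinPA"
proof -
  obtain l where l: "\<And>u x v y. f (u @ [x]) = Some (v @ [y]) \<Longrightarrow> l \<le> length u \<Longrightarrow> x = y"
    using FinPA_level[OF f] by metis
  have "[] \<in> ran g" using FinPA_Nil[OF g] by (auto simp: ran_def)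
  then have nil: "(f |` ran g) [] = Some []" using f by (simp add: FinPA_Nil)
  have snoc: "\<exists>v y. (f |` ran g) u = Some v \<and> w = v @ [y]" if "(f |` ran g) (u @ [x]) = Some w" for u x w
  proof -
    from that have "u @ [x] \<in> ran g" "f (u @ [x]) = Some w"
      by (auto simp: restrict_map_def split: if_splits)
    moreover from this(1) have "u \<in> ran g" by (metis FinPA_ran_snocE[OF g] ranI)
    ultimately show ?thesis using f by (auto elim: FinPA_snocE)
  qed
  have "x = y" if "(f |` ran g) (u @ [x]) = Some (v @ [y])" "l \<le> length u" for u x v y
    using that l by (auto simp: restrict_map_def split: if_splits)
  then show ?thesis unfolding FinPA_iff using nil snoc by blast
qed

section \<open>Building tree maps letter by letter\<close>

text \<open>The letter map applied at a vertex is indexed by the image of the vertex and not by the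
  vertex itself. This lets a retraction choose a letter that keeps the image inside a given subtree, and it
  costs nothing when an injective map is extended, since the image determines the vertex.\<close>

definition tree_map :: "('a list \<Rightarrow> 'a \<Rightarrow> 'a) \<Rightarrow> 'a list \<Rightarrow> 'a list" where
  "tree_map \<tau> w = foldl (\<lambda>v x. v @ [\<tau> v x]) [] w"

lemma tree_map_simps [simp]:
  "tree_map \<tau> [] = []" "tree_map \<tau> (w @ [x]) = tree_map \<tau> w @ [\<tau> (tree_map \<tau> w) x]"
  by (simp_all add: tree_map_def)

lemma length_tree_map [simp]: "length (tree_map \<tau> w) = length w"
  by (induction w rule: rev_induct) simp_all

lemma tree_map_FinPA:
  assumes "\<And>u x. l \<le> length u \<Longrightarrow> \<tau> (tree_map \<tau> u) x = x"
  shows "(\<lambda>w. Some (tree_map \<tau> w)) \<in> carrier FinPA"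
  unfolding FinPA_iff using assms by (auto intro!: exI[of _ l])

lemma inj_tree_map:
  assumes "\<And>v. inj (\<tau> v)"
  shows "inj (tree_map \<tau>)"
proof (rule injI)
  fix u w assume "tree_map \<tau> u = tree_map \<tau> w"
  then show "u = w"
  proof (induction u arbitrary: w rule: rev_induct)
    case Nil
    then show ?case by (metis length_tree_map length_0_conv)
  next
    case (snoc x u)
    then obtain w' x' where w: "w = w' @ [x']"
      by (metis append_is_Nil_conv length_0_conv length_tree_map not_Cons_self2 rev_exhaust)
    with snoc show ?case using assms by (auto dest: injD)
  qed
qed

text \<open>The complements of the domain and of the range of a partial injection of a finite set have the
  same size.\<close>

lemma partial_injection_extends:
  fixes R :: "('a::finite \<times> 'a) set"
  assumes R: "\<And>z y z' y'. (z, y) \<in> R \<Longrightarrow> (z', y') \<in> R \<Longrightarrow> z = z' \<longleftrightarrow> y = y'"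
  shows "\<exists>\<pi>. inj \<pi> \<and> (\<forall>z y. (z, y) \<in> R \<longrightarrow> \<pi> z = y)"
proof -
  define q where "q z = (THE y. (z, y) \<in> R)" for z
  have q: "q z = y" if "(z, y) \<in> R" for z y
    unfolding q_def using that R by blast
  have "inj_on q (Domain R)" using q R by (auto intro!: inj_onI)
  moreover have "q ` Domain R = Range R" using q by force
  ultimately have bij: "bij_betw q (Domain R) (Range R)" by (simp add: bij_betw_def)
  have "card (- Domain R) = card (- Range R)"
    using bij_betw_same_card[OF bij] by (simp add: Compl_eq_Diff_UNIV card_Diff_subset)
  then obtain q' where q': "bij_betw q' (- Domain R) (- Range R)"
    using finite_same_card_bij[of "- Domain R" "- Range R"] by auto
  define \<pi> where "\<pi> z = (if z \<in> Domain R then q z else q' z)" for z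
  have "bij_betw \<pi> (Domain R \<union> - Domain R) (Range R \<union> - Range R)"
    unfolding \<pi>_def by (rule bij_betw_disjoint_Un[OF bij q']) auto
  then have "inj \<pi>" by (simp add: bij_betw_def)
  moreover have "\<pi> z = y" if "(z, y) \<in> R" for z y
    using that q by (auto simp: \<pi>_def)
  ultimately show ?thesis by blast
qed

text \<open>Over an image vertex \<open>v = p w\<close> the children of \<open>w\<close> in the domain are matched injectively with
  children of \<open>v\<close>; the matching is extended to a permutation of the alphabet. Beyond the level \<open>l\<close>
  from which \<open>p\<close> copies letters the matching is part of the identity, and choosing the identity there
  keeps the extension finitary.\<close>

lemma injective_extends_FinSA:
  assumes p: "p \<in> carrier FinPA" and inj: "inj_on p (dom p)"
  shows "\<exists>h\<in>carrier FinSA. p \<subseteq>\<^sub>m h"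
proof -
  obtain l where l: "\<And>u x v y. p (u @ [x]) = Some (v @ [y]) \<Longrightarrow> l \<le> length u \<Longrightarrow> x = y"
    using FinPA_level[OF p] by metis
  have inj': "w = w'" if "p w = Some v" "p w' = Some v" for w w' v
    using inj_onD[OF inj, of w w'] that by auto
  have "\<exists>\<pi>. inj \<pi> \<and> (l \<le> length v \<longrightarrow> \<pi> = id) \<and>
      (\<forall>w z y. p (w @ [z]) = Some (v @ [y]) \<longrightarrow> \<pi> z = y)" for v
  proof (cases "l \<le> length v")
    case True
    have "z = y" if "p (w @ [z]) = Some (v @ [y])" for w z y
      using l[OF that] FinPA_length[OF p that] True by simp
    then show ?thesis by (intro exI[of _ id]) auto
  next
    case False
    let ?R = "{(z, y). \<exists>w. p (w @ [z]) = Some (v @ [y])}"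
    have "z = z' \<longleftrightarrow> y = y'" if "(z, y) \<in> ?R" "(z', y') \<in> ?R" for z y z' y'
    proof -
      from that obtain w w' where w: "p (w @ [z]) = Some (v @ [y])" "p (w' @ [z']) = Some (v @ [y'])"
        by blast
      then have "p w = Some v" "p w' = Some v" using p by (auto elim: FinPA_snocE)
      then have "w = w'" by (rule inj')
      with w show ?thesis using inj'[of "w @ [z]" "v @ [y]" "w @ [z']"] by auto
    qed
    then have "\<exists>\<pi>. inj \<pi> \<and> (\<forall>z y. (z, y) \<in> ?R \<longrightarrow> \<pi> z = y)"
      by (rule partial_injection_extends)
    with False show ?thesis by auto
  qed
  then obtain \<tau> where \<tau>: "\<And>v. inj (\<tau> v)" "\<And>v. l \<le> length v \<Longrightarrow> \<tau> v = id"
    "\<And>v w z y. p (w @ [z]) = Some (v @ [y]) \<Longrightarrow> \<tau> v z = y"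
    by metis
  let ?h = "\<lambda>w. Some (tree_map \<tau> w)"
  have "?h \<in> carrier FinPA" by (rule tree_map_FinPA[of l]) (simp add: \<tau>(2))
  moreover have "inj ?h" using inj_tree_map[of \<tau>, OF \<tau>(1)] by (auto intro!: injI dest: injD)
  moreover have "p w = Some v \<Longrightarrow> tree_map \<tau> w = v" for w v
  proof (induction w arbitrary: v rule: rev_induct)
    case Nil
    then show ?case using p by (simp add: FinPA_Nil)
  next
    case (snoc z w)
    then obtain v' y where "p w = Some v'" "v = v' @ [y]" using p by (auto elim: FinPA_snocE)
    with snoc show ?case using \<tau>(3) by simp
  qed
  then have "p \<subseteq>\<^sub>m ?h" by (auto simp: map_le_def)
  ultimately show ?thesis by (intro bexI[of _ ?h]) auto
qed

text \<open>The range of a total map has no leaves, so a word leaving the range can be redirected to some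
  child inside it. Beyond the level from which \<open>f\<close> copies letters, every child of a vertex of the
  range is in the range, so no redirection happens there and the retraction is finitary.\<close>

lemma FinA_retraction:
  assumes f: "f \<in> carrier FinA"
  shows "\<exists>r\<in>carrier FinA. ran r = ran f \<and> (\<forall>w\<in>ran f. r w = Some w)"
proof -
  have f': "f \<in> carrier FinPA" and dom: "\<And>u. \<exists>v. f u = Some v"
    using f by auto
  obtain l where l: "\<And>u x v y. f (u @ [x]) = Some (v @ [y]) \<Longrightarrow> l \<le> length u \<Longrightarrow> x = y"
    using FinPA_level[OF f'] by metis
  have child: "\<exists>y. v @ [y] \<in> ran f \<and> (l \<le> length v \<longrightarrow> y = x)" if "v \<in> ran f" for v x
  proof -
    from that obtain u where u: "f u = Some v" by (auto simp: ran_def)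
    obtain w where w: "f (u @ [x]) = Some w" using dom by blast
    with u obtain y where "w = v @ [y]" using FinPA_snocE[OF f' w] by auto
    with w have "f (u @ [x]) = Some (v @ [y])" by simp
    then show ?thesis using l FinPA_length[OF f' u] by (metis ranI)
  qed
  define \<tau> where "\<tau> v x = (if v @ [x] \<in> ran f then x else SOME y. v @ [y] \<in> ran f)" for v x
  have in_ran: "tree_map \<tau> w \<in> ran f" for w
  proof (induction w rule: rev_induct)
    case Nil
    then show ?case using FinPA_Nil[OF f'] by (auto simp: ran_def)
  next
    case (snoc x w)
    have "\<exists>y. tree_map \<tau> w @ [y] \<in> ran f" using child[OF snoc] by blast
    from someI_ex[OF this] have "tree_map \<tau> w @ [\<tau> (tree_map \<tau> w) x] \<in> ran f"
      unfolding \<tau>_def[of "tree_map \<tau> w" x] by simp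
    then show ?case by simp
  qed
  have fixed: "w \<in> ran f \<Longrightarrow> tree_map \<tau> w = w" for w
  proof (induction w rule: rev_induct)
    case (snoc x w)
    then have "w \<in> ran f" by (metis FinPA_ran_snocE[OF f'] ranI)
    with snoc show ?case by (simp add: \<tau>_def)
  qed simp
  let ?r = "\<lambda>w. Some (tree_map \<tau> w)"
  have "?r \<in> carrier FinPA"
  proof (rule tree_map_FinPA)
    fix u :: "'a list" and x :: 'a assume "l \<le> length u"
    then show "\<tau> (tree_map \<tau> u) x = x"
      using child[OF in_ran, of u x] by (auto simp: \<tau>_def)
  qed
  moreover have "ran ?r = ran f"
    using in_ran fixed by (auto simp: ran_def)
  ultimately show ?thesis using fixed by (intro bexI[of _ ?r]) auto
qed

text \<open>Here the range may have leaves, but the partial identity on the range is available.\<close>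

lemma FinPA_retraction:
  assumes f: "f \<in> carrier FinPA"
  shows "\<exists>r\<in>carrier FinPA. ran r = ran f \<and> (\<forall>w\<in>ran f. r w = Some w)"
  using FinPA_restrict_ran[OF Some_FinPA f]
  by (intro bexI[of _ "Some |` ran f"]) (auto simp: ran_def restrict_map_def)

section \<open>Conjugacy in the two semigroups\<close>

locale fin_semigroup =
  fixes S :: "('a::finite list \<rightharpoonup> 'a list) monoid"
  assumes S: "S = FinA \<or> S = FinPA"
begin

lemma S_simps [simp]: "f \<otimes>\<^bsub>S\<^esub> g = g \<circ>\<^sub>m f" "\<one>\<^bsub>S\<^esub> = Some"
  using S by auto

lemma carrier_FinPA: "f \<in> carrier S \<Longrightarrow> f \<in> carrier FinPA"
  using S by auto

lemma FinSA_carrier: "f \<in> carrier FinSA \<Longrightarrow> f \<in> carrier S"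
  using S by auto

sublocale monoid S
  using S monoid_FinA monoid_FinPA by auto

lemma retraction:
  assumes "f \<in> carrier S"
  obtains r where "r \<in> carrier S" "ran r = ran f" "\<And>w. w \<in> ran f \<Longrightarrow> r w = Some w"
  using S FinA_retraction[of f] FinPA_retraction[of f] assms by auto

lemma S_closed: "f \<in> carrier S \<Longrightarrow> g \<in> carrier S \<Longrightarrow> g \<circ>\<^sub>m f \<in> carrier S"
  using m_closed[of f g] by simp

lemma pow_apply: "(f [^]\<^bsub>S\<^esub> n) w = ((\<lambda>z. Option.bind z f) ^^ n) (Some w)" for n :: nat
  by (induction n) (simp_all add: map_comp_bind)

lemma pow_Suc: "f [^]\<^bsub>S\<^esub> Suc n = f \<circ>\<^sub>m f [^]\<^bsub>S\<^esub> n"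
  by simp

lemma pow_Suc2: "f \<in> carrier S \<Longrightarrow> f [^]\<^bsub>S\<^esub> Suc n = f [^]\<^bsub>S\<^esub> n \<circ>\<^sub>m f"
  using nat_pow_Suc2[of f n] by simp

text \<open>Undefinedness is treated as one more point of the orbit, absorbing for the Kleisli extension of
  \<open>f\<close>. Since \<open>f\<close> changes only the first \<open>l\<close> letters, the orbit of every word has at most one point
  more than there are words of length at most \<open>l\<close>.\<close>

lemma idempotent_power:
  assumes f: "f \<in> carrier S"
  shows "\<exists>t::nat\<ge>1. f [^]\<^bsub>S\<^esub> t \<circ>\<^sub>m f [^]\<^bsub>S\<^esub> t = f [^]\<^bsub>S\<^esub> t"
proof -
  obtain l where l: "\<And>u v. f u = Some v \<Longrightarrow> drop l v = drop l u"
    using FinPA_drop[OF carrier_FinPA[OF f]] by blast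
  let ?F = "\<lambda>z. Option.bind z f"
  let ?P = "{p :: 'a list. length p \<le> l}"
  define B where "B w = insert None (Some ` (\<lambda>p. p @ drop l w) ` ?P)" for w
  have fin: "finite ?P" using finite_lists_length_le[of "UNIV :: 'a set" l] by simp
  have card: "card (B w) \<le> Suc (card ?P)" for w
  proof -
    have "card (Some ` (\<lambda>p. p @ drop l w) ` ?P) \<le> card ?P"
      unfolding image_image by (rule card_image_le[OF fin])
    then show ?thesis unfolding B_def using fin by (simp add: card_insert_if)
  qed
  have tail: "drop l v = drop l w" if "(?F ^^ i) (Some w) = Some v" for i w v
    using that by (induction i arbitrary: v) (auto simp: bind_eq_Some_conv dest: l)
  have orbit: "(?F ^^ i) (Some w) \<in> B w" for i w
  proof (cases "(?F ^^ i) (Some w)")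
    case (Some v)
    then have "v = take l v @ drop l w" using tail by (metis append_take_drop_id)
    then show ?thesis unfolding B_def Some by (intro insertI2 imageI image_eqI[of _ _ "take l v"]) auto
  qed (simp add: B_def)
  define t :: nat where "t = fact (Suc (card ?P))"
  have "(?F ^^ (t + t)) (Some w) = (?F ^^ t) (Some w)" for w
    unfolding t_def by (rule funpow_fact_idem[OF _ card orbit]) (simp add: B_def fin)
  then have "f [^]\<^bsub>S\<^esub> (t + t) = f [^]\<^bsub>S\<^esub> t"
    by (auto simp: pow_apply)
  moreover have "t \<ge> 1" by (simp add: t_def del: fact_Suc)
  ultimately show ?thesis using nat_pow_mult[OF f, of t t] by auto
qed

lemma common_idempotent_power:
  assumes f: "f \<in> carrier S" and g: "g \<in> carrier S"
  obtains t :: nat where "t \<ge> 1" "f [^]\<^bsub>S\<^esub> t \<circ>\<^sub>m f [^]\<^bsub>S\<^esub> t = f [^]\<^bsub>S\<^esub> t"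
    "g [^]\<^bsub>S\<^esub> t \<circ>\<^sub>m g [^]\<^bsub>S\<^esub> t = g [^]\<^bsub>S\<^esub> t"
proof -
  obtain s t :: nat where s: "s \<ge> 1" "f [^]\<^bsub>S\<^esub> s \<circ>\<^sub>m f [^]\<^bsub>S\<^esub> s = f [^]\<^bsub>S\<^esub> s"
    and t: "t \<ge> 1" "g [^]\<^bsub>S\<^esub> t \<circ>\<^sub>m g [^]\<^bsub>S\<^esub> t = g [^]\<^bsub>S\<^esub> t"
    using idempotent_power[OF f] idempotent_power[OF g] by blast
  have pow: "e [^]\<^bsub>S\<^esub> Suc n = e" if "e \<circ>\<^sub>m e = e" for e and n :: nat
    using that by (induction n) auto
  have "f [^]\<^bsub>S\<^esub> (s * t) = f [^]\<^bsub>S\<^esub> s"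
    using pow[OF s(2), of "t - 1"] t(1) nat_pow_pow[OF f, of s t] by (simp del: nat_pow_Suc)
  moreover have "g [^]\<^bsub>S\<^esub> (s * t) = g [^]\<^bsub>S\<^esub> t"
    using pow[OF t(2), of "s - 1"] s(1) nat_pow_pow[OF g, of t s] by (simp del: nat_pow_Suc add: mult.commute)
  ultimately show thesis using that[of "s * t"] s t by simp
qed

text \<open>On \<open>ran e\<close>, where \<open>e\<close> is the idempotent power of \<open>f\<close>, the element \<open>f e = e f\<close> agrees with \<open>f\<close>,
  and both \<open>e\<close> and \<open>f e\<close> have range \<open>ran e\<close> because \<open>e = e e\<close> is a left multiple of \<open>f e\<close>.\<close>

lemma core_eq:
  fixes t :: nat
  assumes f: "f \<in> carrier S" and t: "t \<ge> 1" "f [^]\<^bsub>S\<^esub> t \<circ>\<^sub>m f [^]\<^bsub>S\<^esub> t = f [^]\<^bsub>S\<^esub> t"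
  shows "restrict_ran (f \<otimes>\<^bsub>S\<^esub> idem_of S f) = f |` ran (f [^]\<^bsub>S\<^esub> t)"
proof -
  let ?e = "f [^]\<^bsub>S\<^esub> t"
  have idem: "idem_of S f = ?e" by (rule idem_of_eq[OF f t(1)]) (simp add: t(2))
  obtain k where k: "t = Suc k" using t(1) by (cases t) auto
  have comm: "?e \<circ>\<^sub>m f = f \<circ>\<^sub>m ?e" using pow_Suc2[OF f, of t] by simp
  have "?e = (?e \<circ>\<^sub>m f) \<circ>\<^sub>m (f [^]\<^bsub>S\<^esub> k)"
    using t(2) pow_Suc[of f k] unfolding k map_comp_assoc_rev[symmetric] by simp
  then have "ran ?e \<subseteq> ran (?e \<circ>\<^sub>m f)" by (metis ran_map_comp_subset)
  moreover have "ran (?e \<circ>\<^sub>m f) \<subseteq> ran ?e" by (rule ran_map_comp_subset)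
  ultimately have ran: "ran (?e \<circ>\<^sub>m f) = ran ?e" by blast
  have "(?e \<circ>\<^sub>m f) w = f w" if "w \<in> ran ?e" for w
    unfolding comm using idem_on_ran[OF t(2) that] by simp
  then show ?thesis
    unfolding restrict_ran_def by (auto simp: idem ran restrict_map_def)
qed

lemma p_conj_refl: "f \<in> carrier S \<Longrightarrow> p_conj S f f"
  unfolding p_conj_def by (intro bexI[of _ f] bexI[of _ Some]) (use one_closed in auto)

lemma S_conj_sym: "S_conj S f g \<Longrightarrow> S_conj S g f"
proof -
  assume "S_conj S f g"
  moreover have "(p_conj S)\<inverse>\<inverse> = p_conj S"
    by (auto simp: p_conj_def fun_eq_iff)
  ultimately show "S_conj S g f"
    unfolding S_conj_def by (metis conversepI tranclp_converse)
qed

lemma S_conj_trans: "S_conj S f g \<Longrightarrow> S_conj S g h \<Longrightarrow> S_conj S f h"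
  unfolding S_conj_def by (rule tranclp_trans)

text \<open>In left-to-right notation, \<open>f = f r\<close> and \<open>r f\<close> are products of the same two factors.\<close>

lemma S_conj_retract:
  assumes "f \<in> carrier S" "r \<in> carrier S" "r \<circ>\<^sub>m f = f"
  shows "S_conj S f (f \<circ>\<^sub>m r)"
  unfolding S_conj_def p_conj_def using assms by (intro tranclp.r_into_trancl) force

text \<open>After \<open>n\<close> retractions \<open>f\<close> has been replaced by a conjugate \<open>p\<close> whose range is that of
  \<open>f [^] (n + 1)\<close> and which agrees with \<open>f\<close> on this range. Once the range is that of the idempotent
  power, this power itself serves as the last retraction and turns \<open>p\<close> into the required product.\<close>

lemma S_conj_core:
  fixes t :: nat
  assumes f: "f \<in> carrier S" and t: "t \<ge> 1" "f [^]\<^bsub>S\<^esub> t \<circ>\<^sub>m f [^]\<^bsub>S\<^esub> t = f [^]\<^bsub>S\<^esub> t"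
  shows "S_conj S f (f \<circ>\<^sub>m f [^]\<^bsub>S\<^esub> t)"
proof -
  have "\<exists>p\<in>carrier S. S_conj S f p \<and> ran p = ran (f [^]\<^bsub>S\<^esub> Suc n) \<and>
      (\<forall>w\<in>ran (f [^]\<^bsub>S\<^esub> Suc n). p w = f w)" for n
  proof (induction n)
    case 0
    then show ?case
      using f p_conj_refl[OF f] by (intro bexI[of _ f]) (auto simp: S_conj_def)
  next
    case (Suc n)
    then obtain p where p: "p \<in> carrier S" "S_conj S f p" "ran p = ran (f [^]\<^bsub>S\<^esub> Suc n)"
      "\<And>w. w \<in> ran (f [^]\<^bsub>S\<^esub> Suc n) \<Longrightarrow> p w = f w" by blast
    obtain r where r: "r \<in> carrier S" "ran r = ran p" "\<And>w. w \<in> ran p \<Longrightarrow> r w = Some w"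
      using retraction[OF p(1)] by metis
    have "(r \<circ>\<^sub>m p) w = p w" for w
      using r(3) by (cases "p w") (auto intro: ranI)
    then have "S_conj S p (p \<circ>\<^sub>m r)" by (intro S_conj_retract[OF p(1) r(1)]) auto
    then have conj: "S_conj S f (p \<circ>\<^sub>m r)" using p(2) S_conj_trans by blast
    have ran: "ran (p \<circ>\<^sub>m r) = ran (f [^]\<^bsub>S\<^esub> Suc (Suc n))"
      unfolding set_eq_iff ran_map_comp_iff r(2) pow_Suc[of f "Suc n"] p(3) using p(4) by auto
    have "ran (f [^]\<^bsub>S\<^esub> Suc (Suc n)) \<subseteq> ran (f [^]\<^bsub>S\<^esub> Suc n)"
      unfolding pow_Suc2[OF f, of "Suc n"] by (rule ran_map_comp_subset)
    then have "(p \<circ>\<^sub>m r) w = f w" if "w \<in> ran (f [^]\<^bsub>S\<^esub> Suc (Suc n))" for w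
      using that r(3)[of w] p(3,4) by (auto simp del: nat_pow_Suc)
    with conj ran show ?case using S_closed[OF r(1) p(1)] by blast
  qed
  from this[of "t - 1"] t(1) obtain p where p: "p \<in> carrier S" "S_conj S f p" "ran p = ran (f [^]\<^bsub>S\<^esub> t)"
      "\<And>w. w \<in> ran (f [^]\<^bsub>S\<^esub> t) \<Longrightarrow> p w = f w" by auto
  have "(f [^]\<^bsub>S\<^esub> t \<circ>\<^sub>m p) w = p w" for w
    using idem_on_ran[OF t(2)] p(3) by (cases "p w") (auto intro: ranI)
  then have "S_conj S p (p \<circ>\<^sub>m f [^]\<^bsub>S\<^esub> t)"
    by (intro S_conj_retract[OF p(1) nat_pow_closed[OF f]]) auto
  moreover have "(p \<circ>\<^sub>m f [^]\<^bsub>S\<^esub> t) w = (f \<circ>\<^sub>m f [^]\<^bsub>S\<^esub> t) w" for w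
    using p(4) by (cases "(f [^]\<^bsub>S\<^esub> t) w") (auto intro: ranI)
  ultimately show ?thesis using p(2) S_conj_trans by (metis ext)
qed

lemma pow_shift:
  fixes n :: nat
  assumes x: "x \<in> carrier S" and y: "y \<in> carrier S"
  shows "x \<circ>\<^sub>m (y \<circ>\<^sub>m x) [^]\<^bsub>S\<^esub> n = (x \<circ>\<^sub>m y) [^]\<^bsub>S\<^esub> n \<circ>\<^sub>m x"
proof (induction n)
  case (Suc n)
  have "x \<circ>\<^sub>m (y \<circ>\<^sub>m x) [^]\<^bsub>S\<^esub> Suc n = (x \<circ>\<^sub>m y) \<circ>\<^sub>m (x \<circ>\<^sub>m (y \<circ>\<^sub>m x) [^]\<^bsub>S\<^esub> n)"
    by (simp add: map_comp_assoc_rev)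
  also have "\<dots> = (x \<circ>\<^sub>m y) [^]\<^bsub>S\<^esub> Suc n \<circ>\<^sub>m x"
    unfolding Suc by (simp add: map_comp_assoc_rev)
  finally show ?case .
qed simp

text \<open>Let \<open>f = x y\<close> and \<open>g = y x\<close>, and let \<open>e\<close> and \<open>d\<close> be their idempotent powers. The factor \<open>x\<close>
  is injective on \<open>ran e\<close> because \<open>f\<close> factors through it and \<open>f\<close> permutes
  \<open>ran e\<close>. Its extension \<open>h\<close> sends no vertex outside \<open>ran e\<close> into \<open>ran d\<close>, because \<open>x\<close> already
  maps \<open>ran e\<close> onto \<open>ran d\<close>.\<close>

lemma p_conj_FinSA_conj_core:
  assumes "p_conj S f g"
  shows "FinSA_conj (restrict_ran (f \<otimes>\<^bsub>S\<^esub> idem_of S f)) (restrict_ran (g \<otimes>\<^bsub>S\<^esub> idem_of S g))"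
proof -
  from assms obtain x y where x: "x \<in> carrier S" and y: "y \<in> carrier S"
    and f: "f = y \<circ>\<^sub>m x" and g: "g = x \<circ>\<^sub>m y"
    by (auto simp: p_conj_def)
  have fS: "f \<in> carrier S" and gS: "g \<in> carrier S"
    unfolding f g using x y S_closed by auto
  obtain t :: nat where t: "t \<ge> 1" "f [^]\<^bsub>S\<^esub> t \<circ>\<^sub>m f [^]\<^bsub>S\<^esub> t = f [^]\<^bsub>S\<^esub> t"
    "g [^]\<^bsub>S\<^esub> t \<circ>\<^sub>m g [^]\<^bsub>S\<^esub> t = g [^]\<^bsub>S\<^esub> t"
    using common_idempotent_power[OF fS gS] .
  obtain k where k: "t = Suc k" using t(1) by (cases t) auto
  define e where "e = f [^]\<^bsub>S\<^esub> t"
  define d where "d = g [^]\<^bsub>S\<^esub> t"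
  have eS: "e \<in> carrier S" unfolding e_def using fS by simp
  have e_fix: "e w = Some w" if "w \<in> ran e" for w
    using idem_on_ran[OF t(2)] that unfolding e_def by blast
  have xd: "x \<circ>\<^sub>m e = d \<circ>\<^sub>m x" unfolding e_def d_def f g by (rule pow_shift[OF x y])
  have fx: "x \<circ>\<^sub>m f = g \<circ>\<^sub>m x" unfolding f g by (rule map_comp_assoc_rev)
  have fe: "f \<circ>\<^sub>m e = e \<circ>\<^sub>m f" unfolding e_def using pow_Suc2[OF fS, of t] by simp
  \<comment> \<open>This factorization of \<open>d\<close> ends with \<open>e\<close> followed by \<open>x\<close>: every point of \<open>ran d\<close> has the form
    \<open>x w\<close> with \<open>w\<close> in \<open>ran e\<close>.\<close>
  have d_via: "d = x \<circ>\<^sub>m (e \<circ>\<^sub>m (y \<circ>\<^sub>m g [^]\<^bsub>S\<^esub> k))"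
    using t(3) pow_Suc[of g k] unfolding map_comp_assoc_rev xd unfolding d_def k g
    unfolding map_comp_assoc_rev[symmetric] by simp
  have f_inj: "w = w'" if w: "w \<in> ran e" "w' \<in> ran e" and "f w = f w'" for w w'
  proof -
    have "e = f [^]\<^bsub>S\<^esub> k \<circ>\<^sub>m f" unfolding e_def k using pow_Suc2[OF fS] .
    then have "e w = e w'" using that(3) by (simp add: map_comp_bind)
    then show ?thesis using e_fix w by simp
  qed
  have f_ran: "\<exists>w'\<in>ran e. f w = Some w'" if w: "w \<in> ran e" for w
  proof -
    have "e = f [^]\<^bsub>S\<^esub> k \<circ>\<^sub>m f" unfolding e_def k using pow_Suc2[OF fS] .
    then obtain w' where w': "f w = Some w'" using e_fix[OF w] by (metis map_comp_Some_iff)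
    moreover have "(e \<circ>\<^sub>m f) w = Some w'" using e_fix[OF w] w' unfolding fe[symmetric] by simp
    ultimately show ?thesis by (auto intro: ranI)
  qed
  define p where "p = x |` ran e"
  have "p \<in> carrier FinPA"
    unfolding p_def using FinPA_restrict_ran carrier_FinPA x eS by blast
  moreover have "inj_on p (dom p)"
    by (rule inj_onI, rule f_inj) (auto simp: p_def f map_comp_bind)
  ultimately obtain h where h: "h \<in> carrier FinSA" and ph: "p \<subseteq>\<^sub>m h"
    using injective_extends_FinSA by blast
  have hx: "h w = x w" "x w \<noteq> None" if w: "w \<in> ran e" for w
  proof -
    show "x w \<noteq> None" using f_ran[OF w] by (auto simp: f map_comp_Some_iff)
    then have "w \<in> dom p" using w by (auto simp: p_def)
    with ph have "p w = h w" by (auto simp: map_le_def)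
    then show "h w = x w" using w by (simp add: p_def)
  qed
  have "(h \<circ>\<^sub>m (f |` ran e)) w = ((g |` ran d) \<circ>\<^sub>m h) w" for w
  proof (cases "w \<in> ran e")
    case True
    obtain w' where w': "w' \<in> ran e" "f w = Some w'" using f_ran[OF True] by blast
    obtain v where v: "x w = Some v" using hx(2)[OF True] by blast
    have "d v = Some v" using arg_cong[OF xd, of "\<lambda>q. q w"] v e_fix[OF True] by simp
    then have "v \<in> ran d" by (rule ranI)
    moreover have "x w' = g v" using arg_cong[OF fx, of "\<lambda>q. q w"] v w' by simp
    ultimately show ?thesis using True v w' hx(1) by simp
  next
    case False
    obtain v where v: "h w = Some v" using h by (metis FinSA_simps(3) UNIV_I domD)
    have "v \<notin> ran d"
    proof
      assume "v \<in> ran d"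
      then have "v \<in> ran (x \<circ>\<^sub>m (e \<circ>\<^sub>m (y \<circ>\<^sub>m g [^]\<^bsub>S\<^esub> k)))" using d_via by simp
      then obtain w' where "w' \<in> ran e" "x w' = Some v"
        using ran_map_comp_subset[of e] by (auto simp only: ran_map_comp_iff[of v x])
      then have "h w' = h w" using v hx by simp
      then have "w' = w" using h by (auto dest: injD)
      with \<open>w' \<in> ran e\<close> False show False by simp
    qed
    with False v show ?thesis by simp
  qed
  then have "FinSA_conj (f |` ran e) (g |` ran d)"
    unfolding FinSA_conj_iff using h by blast
  then show ?thesis
    unfolding core_eq[OF fS t(1,2)] core_eq[OF gS t(1,3)] e_def d_def .
qed

text \<open>Let \<open>e\<close> and \<open>d\<close> be the idempotent powers of \<open>f\<close> and \<open>g\<close>. Both \<open>f\<close> and \<open>g\<close> may be replaced by \<open>f e\<close> and \<open>g d\<close>, and for these a single elementary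
  conjugation suffices: \<open>h\<close> carries \<open>ran e\<close> onto \<open>ran d\<close>, so the idempotents \<open>e\<close> and \<open>d\<close> cut \<open>h\<close>
  and its inverse \<open>k\<close> down to mutually inverse maps between these ranges.\<close>

lemma FinSA_conj_core_S_conj:
  assumes fS: "f \<in> carrier S" and gS: "g \<in> carrier S"
    and conj: "FinSA_conj (restrict_ran (f \<otimes>\<^bsub>S\<^esub> idem_of S f)) (restrict_ran (g \<otimes>\<^bsub>S\<^esub> idem_of S g))"
  shows "S_conj S f g"
proof -
  obtain t :: nat where t: "t \<ge> 1" "f [^]\<^bsub>S\<^esub> t \<circ>\<^sub>m f [^]\<^bsub>S\<^esub> t = f [^]\<^bsub>S\<^esub> t"
    "g [^]\<^bsub>S\<^esub> t \<circ>\<^sub>m g [^]\<^bsub>S\<^esub> t = g [^]\<^bsub>S\<^esub> t"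
    using common_idempotent_power[OF fS gS] .
  define e where "e = f [^]\<^bsub>S\<^esub> t"
  define d where "d = g [^]\<^bsub>S\<^esub> t"
  have eS: "e \<in> carrier S" and dS: "d \<in> carrier S" unfolding e_def d_def using fS gS by auto
  have "FinSA_conj (f |` ran e) (g |` ran d)"
    using conj unfolding core_eq[OF fS t(1,2)] core_eq[OF gS t(1,3)] e_def d_def .
  then obtain h where h: "h \<in> carrier FinSA" and hfg: "h \<circ>\<^sub>m (f |` ran e) = (g |` ran d) \<circ>\<^sub>m h"
    unfolding FinSA_conj_iff by blast
  obtain k where k: "k \<in> carrier FinSA" "h \<circ>\<^sub>m k = Some" "k \<circ>\<^sub>m h = Some"
    using FinSA_inverse[OF h] .
  define x where "x = h \<circ>\<^sub>m e"
  define y where "y = (f \<circ>\<^sub>m e) \<circ>\<^sub>m (k \<circ>\<^sub>m d)"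
  have xS: "x \<in> carrier S" and yS: "y \<in> carrier S"
    unfolding x_def y_def using S_closed FinSA_carrier h k(1) eS dS fS by auto
  have e_fix: "e w = Some w" if "w \<in> ran e" for w
    using idem_on_ran[OF t(2)] that unfolding e_def by blast
  have d_fix: "d w = Some w" if "w \<in> ran d" for w
    using idem_on_ran[OF t(3)] that unfolding d_def by blast
  have f_defined: "\<exists>w'. f w = Some w'" if "w \<in> ran e" for w
  proof -
    obtain j where j: "t = Suc j" using t(1) by (cases t) auto
    have "e = f [^]\<^bsub>S\<^esub> j \<circ>\<^sub>m f" unfolding e_def j using pow_Suc2[OF fS] .
    then show ?thesis using e_fix[OF that] by (metis map_comp_Some_iff)
  qed
  have g_defined: "\<exists>w'. g w = Some w'" if "w \<in> ran d" for w
  proof -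
    obtain j where j: "t = Suc j" using t(1) by (cases t) auto
    have "d = g [^]\<^bsub>S\<^esub> j \<circ>\<^sub>m g" unfolding d_def j using pow_Suc2[OF gS] .
    then show ?thesis using d_fix[OF that] by (metis map_comp_Some_iff)
  qed
  have h_total: "\<exists>v. h w = Some v" for w using h by (metis FinSA_simps(3) UNIV_I domD)
  have h_ran: "w \<in> ran e \<longleftrightarrow> v \<in> ran d" and h_comm: "w \<in> ran e \<Longrightarrow> (h \<circ>\<^sub>m f) w = g v"
    if "h w = Some v" for w v
  proof -
    have eq: "(h \<circ>\<^sub>m (f |` ran e)) w = (g |` ran d) v"
      unfolding hfg using that by simp
    show iff: "w \<in> ran e \<longleftrightarrow> v \<in> ran d"
    proof
      assume w: "w \<in> ran e"
      obtain w' v' where "f w = Some w'" "h w' = Some v'" using f_defined[OF w] h_total by blast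
      then have "(g |` ran d) v = Some v'" using eq w by simp
      then show "v \<in> ran d" by (metis option.distinct(1) restrict_out)
    next
      assume v: "v \<in> ran d"
      then obtain v' where "g v = Some v'" using g_defined by blast
      then have "(h \<circ>\<^sub>m (f |` ran e)) w = Some v'" using eq v by simp
      then show "w \<in> ran e" by (metis map_comp_simps(1) option.distinct(1) restrict_out)
    qed
    assume "w \<in> ran e"
    then show "(h \<circ>\<^sub>m f) w = g v" using eq iff by (simp add: map_comp_bind)
  qed
  have kh: "k v = Some w" if "h w = Some v" for v w
    using fun_cong[OF k(3), of w] that by simp
  have "(y \<circ>\<^sub>m x) w = (f \<circ>\<^sub>m e) w" for w
  proof (cases "e w")
    case (Some u)
    then have u: "u \<in> ran e" by (rule ranI)
    obtain v where v: "h u = Some v" using h_total by blast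
    have "d v = Some v" using d_fix h_ran[OF v] u by blast
    then show ?thesis using Some v kh[OF v] e_fix[OF u] by (simp add: x_def y_def)
  qed (simp add: x_def)
  moreover have "(x \<circ>\<^sub>m y) w = (g \<circ>\<^sub>m d) w" for w
  proof (cases "d w")
    case (Some v)
    then have v: "v \<in> ran d" by (rule ranI)
    obtain u where u: "k v = Some u" using k(1) by (metis FinSA_simps(3) UNIV_I domD)
    have hu: "h u = Some v" using fun_cong[OF k(2), of v] u by simp
    have ue: "u \<in> ran e" using h_ran[OF hu] v by blast
    have comm: "e \<circ>\<^sub>m f = f \<circ>\<^sub>m e" unfolding e_def using pow_Suc2[OF fS, of t] by simp
    obtain u' where fu: "f u = Some u'" using f_defined[OF ue] by blast
    have "(e \<circ>\<^sub>m f) u = Some u'" unfolding comm using e_fix[OF ue] fu by simp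
    with fu have u': "f u = Some u'" "e u' = Some u'" by simp_all
    have "y w = Some u'" unfolding y_def using Some u e_fix[OF ue] u'(1) by simp
    moreover have "x u' = g v" unfolding x_def using u' h_comm[OF hu ue] by simp
    ultimately show ?thesis using Some by simp
  qed (simp add: y_def)
  ultimately have "f \<circ>\<^sub>m e = y \<circ>\<^sub>m x" "g \<circ>\<^sub>m d = x \<circ>\<^sub>m y" by (simp_all add: fun_eq_iff)
  then have "p_conj S (f \<circ>\<^sub>m e) (g \<circ>\<^sub>m d)"
    unfolding p_conj_def S_simps using xS yS by blast
  then have "S_conj S (f \<circ>\<^sub>m e) (g \<circ>\<^sub>m d)" by (auto simp: S_conj_def)
  moreover have "S_conj S f (f \<circ>\<^sub>m e)" unfolding e_def by (rule S_conj_core[OF fS t(1,2)])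
  moreover have "S_conj S g (g \<circ>\<^sub>m d)" unfolding d_def by (rule S_conj_core[OF gS t(1,3)])
  ultimately show ?thesis using S_conj_sym S_conj_trans by blast
qed

lemma S_conj_FinSA_conj_core:
  assumes "S_conj S f g"
  shows "FinSA_conj (restrict_ran (f \<otimes>\<^bsub>S\<^esub> idem_of S f)) (restrict_ran (g \<otimes>\<^bsub>S\<^esub> idem_of S g))"
  using assms unfolding S_conj_def
proof (induction rule: tranclp_induct)
  case (base g)
  then show ?case by (rule p_conj_FinSA_conj_core)
next
  case (step g h)
  show ?case by (rule FinSA_conj_trans[OF step.IH p_conj_FinSA_conj_core[OF step.hyps(2)]])
qed

end

theorem theorem9:
  fixes S :: "('a::finite list \<rightharpoonup> 'a list) monoid"
    and f g :: "'a list \<rightharpoonup> 'a list"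
  assumes "S = FinA \<or> S = FinPA"
    and "f \<in> carrier S" and "g \<in> carrier S"
  shows "S_conj S f g \<longleftrightarrow>
    FinSA_conj (restrict_ran (f \<otimes>\<^bsub>S\<^esub> idem_of S f)) (restrict_ran (g \<otimes>\<^bsub>S\<^esub> idem_of S g))"
proof -
  interpret fin_semigroup S by unfold_locales (rule assms(1))
  show ?thesis
    using S_conj_FinSA_conj_core FinSA_conj_core_S_conj assms(2,3) by blast
qed

end
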